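(* For every $n\ge 1$, every edge 2-coloring of the $n$-dimensional hypercube $Q_n$ has a color group of size at least $\frac12 n\,2^{\frac n2-1}$; that is, $\mathrm{OPT}(Q_n)\ge \frac12 n 2^{\frac12 n-1}=\frac12 k\log_2 k$ where $k=2^{n/2}$.
   Context: The hypercube $Q_n$ has vertex set $\{0,1\}^n$, two bit strings being adjacent iff they differ in exactly one coordinate. An edge 2-coloring of a graph is an assignment of colors to its edges such that each vertex is incident to edges of at most 2 distinct colors. A color group is the set of all edges receiving a given color. $\mathrm{OPT}(G)$ denotes the minimum, over all edge 2-colorings of $G$, of the size of the largest color group. *)

theory Defs
  imports Complex_Main
begin

text \<open>A simple graph is a pair of a vertex set and a set of edges, each edge being a two-element
  set of vertices.\<close>

type_synonym 'a graph = "'a set \<times> 'a set set"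

abbreviation verts :: "'a graph \<Rightarrow> 'a set" where
  "verts G \<equiv> fst G"

abbreviation edges :: "'a graph \<Rightarrow> 'a set set" where
  "edges G \<equiv> snd G"

definition bit_strings :: "nat \<Rightarrow> bool list set" where
  "bit_strings n = {x. length x = n}"

definition hypercube :: "nat \<Rightarrow> bool list graph" where
  "hypercube n =
     (bit_strings n,
      {{x, y} | x y. x \<in> bit_strings n \<and> y \<in> bit_strings n \<and>
                     card {i. i < n \<and> x ! i \<noteq> y ! i} = 1})"

text \<open>The notions below are meant for finite graphs, so that all cardinalities are those of
  finite sets. The values of a coloring outside the edge set are irrelevant.\<close>

definition edge_2_coloring :: "'a graph \<Rightarrow> ('a set \<Rightarrow> 'c) \<Rightarrow> bool" where
  "edge_2_coloring G c \<longleftrightarrow> (\<forall>v \<in> verts G. card (c ` {e \<in> edges G. v \<in> e}) \<le> 2)"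

definition color_group :: "'a graph \<Rightarrow> ('a set \<Rightarrow> 'c) \<Rightarrow> 'c \<Rightarrow> 'a set set" where
  "color_group G c k = {e \<in> edges G. c e = k}"

text \<open>The maximum ranges over all colors; unused ones have an empty group and do not affect it.
  For finitely many edges the set of sizes is finite even if there are infinitely many colors.\<close>

definition largest_group_size :: "'a graph \<Rightarrow> ('a set \<Rightarrow> 'c) \<Rightarrow> nat" where
  "largest_group_size G c = Max (range (\<lambda>k. card (color_group G c k)))"

text \<open>Natural numbers suffice as colors, since a finite graph uses only finitely many. The minimum
  exists: a constant coloring is always an edge 2-coloring.\<close>

definition OPT :: "'a graph \<Rightarrow> nat" where
  "OPT G = (LEAST m. \<exists>c :: 'a set \<Rightarrow> nat. edge_2_coloring G c \<and> m = largest_group_size G c)"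

end

theory Submission
  imports Defs "HOL-Analysis.Convex"
begin

text \<open>A set of \<open>m\<close> vertices of the hypercube spans at most \<open>m log m / 2\<close> edges (logarithm to
  base 2), by induction on the dimension. In an edge 2-coloring every vertex lies in the vertex sets
  of at most two color groups, so by averaging over the \<open>n 2 ^ (n - 1)\<close> edges some color group has at
  least \<open>n / 4\<close> times as many edges as vertices. By the first bound such a group has at least
  \<open>2 powr (n / 2)\<close> vertices, hence at least \<open>n / 4 * 2 powr (n / 2)\<close> edges.\<close>

section \<open>Logarithmic inequalities\<close>

lemma ln_two_le_mult_ln:
  fixes t :: real
  assumes "t \<ge> 1"
  shows "t * ln (1 + 1 / t) \<ge> ln 2"
proof -
  \<comment> \<open>Since \<open>t \<ge> 1\<close>, the point \<open>1 + 1 / t\<close> divides the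
    segment from 1 to 2 with weight \<open>1 / t\<close>. By concavity \<open>ln\<close> lies above
    its chord there, whose value is \<open>ln 2 / t\<close>.\<close>
  have "concave_on {0<..} (ln :: real \<Rightarrow> real)"
    by (rule ln_concave)
  then have "ln ((1 - 1 / t) * 1 + (1 / t) * 2) \<ge> (1 - 1 / t) * ln 1 + (1 / t) * ln (2::real)"
    using concave_onD[of "{0<..}" ln "1 / t" 1 2] assms by simp
  moreover have "(1 - 1 / t) * 1 + (1 / t) * 2 = 1 + 1 / t"
    using assms by (simp add: field_simps)
  ultimately have "ln 2 / t \<le> ln (1 + 1 / t)"
    by (simp add: add.commute)
  then show ?thesis
    using assms by (simp add: field_simps)
qed

text \<open>Inductive step of the isoperimetric bound: \<open>a\<close> and \<open>b\<close> are the
  sizes of the two halves of a vertex set, and \<open>2 * a\<close> pays for at most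
  \<open>a\<close> edges between them. For \<open>a > 0\<close> and \<open>t = b / a\<close>, the
  growth of x ln x is \<open>a * (ln (1 + t) + t * ln (1 + 1 / t))\<close>, and both summands in the
  bracket are at least \<open>ln 2\<close>.\<close>

lemma xlogx_add_ge:
  fixes a b :: real
  assumes "0 \<le> a" "a \<le> b"
  shows "a * log 2 a + b * log 2 b + 2 * a \<le> (a + b) * log 2 (a + b)"
proof (cases "a = 0")
  case False
  with assms have a: "a > 0" and b: "b > 0" by auto
  define t where "t = b / a"
  have t: "t \<ge> 1" using a assms by (simp add: t_def)
  have bt: "b = a * t" using a by (simp add: t_def)
  have s1: "ln (a + b) = ln a + ln (1 + t)"
  proof -
    have "a + b = a * (1 + t)" by (simp add: bt algebra_simps)
    then show ?thesis using a t by (simp add: ln_mult)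
  qed
  have s2: "ln (a + b) = ln b + ln (1 + 1 / t)"
  proof -
    have "a + b = b * (1 + 1 / t)" using t by (simp add: bt field_simps)
    then show ?thesis using b t by (simp only: ln_mult_pos) (simp add: ln_mult_pos add_pos_nonneg)
  qed
  have "ln 2 \<le> ln (1 + t)" using t by simp
  then have "2 * ln 2 \<le> ln (1 + t) + t * ln (1 + 1 / t)"
    using ln_two_le_mult_ln[OF t] by linarith
  then have "a * (2 * ln 2) \<le> a * (ln (1 + t) + t * ln (1 + 1 / t))"
    using a by (intro mult_left_mono) auto
  also have "\<dots> = a * (ln (a + b) - ln a) + b * (ln (a + b) - ln b)"
  proof -
    have "ln (1 + t) = ln (a + b) - ln a" "ln (1 + 1 / t) = ln (a + b) - ln b"
      using s1 s2 by simp_all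
    then show ?thesis by (simp only: bt distrib_left mult.assoc)
  qed
  finally have "a * ln a + b * ln b + 2 * a * ln 2 \<le> (a + b) * ln (a + b)"
    by (simp add: algebra_simps)
  then have "(a * ln a + b * ln b + 2 * a * ln 2) / ln 2 \<le> (a + b) * ln (a + b) / ln 2"
    by (intro divide_right_mono) auto
  then show ?thesis
    by (simp add: log_def add_divide_distrib)
qed simp

section \<open>Edges of the hypercube and the isoperimetric bound\<close>

lemma finite_bit_strings: "finite (bit_strings n)"
  and card_bit_strings: "card (bit_strings n) = 2 ^ n"
  using card_lists_length_eq[of "UNIV :: bool set" n] finite_lists_length_eq[of "UNIV :: bool set" n]
  by (simp_all add: bit_strings_def)

lemma hypercube_edge_subset: "e \<in> edges (hypercube n) \<Longrightarrow> e \<subseteq> bit_strings n"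
  by (auto simp: hypercube_def)

lemma hypercube_edge_nonempty: "e \<in> edges (hypercube n) \<Longrightarrow> e \<noteq> {}"
  by (auto simp: hypercube_def)

lemma finite_hypercube_edges: "finite (edges (hypercube n))"
  by (rule finite_subset[of _ "Pow (bit_strings n)"])
    (auto simp: finite_bit_strings dest: hypercube_edge_subset)

lemma hypercube_edges_0: "edges (hypercube 0) = {}"
  by (auto simp: hypercube_def)

lemma card_diff_Cons:
  "card {i. i < Suc n \<and> (a # x) ! i \<noteq> (b # y) ! i} =
     (if a = b then 0 else 1) + card {i. i < n \<and> x ! i \<noteq> y ! i}"
proof -
  have "{i. i < Suc n \<and> (a # x) ! i \<noteq> (b # y) ! i} =
      (if a = b then {} else {0}) \<union> Suc ` {i. i < n \<and> x ! i \<noteq> y ! i}"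
  proof (rule set_eqI)
    fix i
    show "i \<in> {i. i < Suc n \<and> (a # x) ! i \<noteq> (b # y) ! i} \<longleftrightarrow>
        i \<in> (if a = b then {} else {0}) \<union> Suc ` {i. i < n \<and> x ! i \<noteq> y ! i}"
      by (cases i) auto
  qed
  then show ?thesis
    by (simp add: card_image card_insert_if)
qed

lemma card_diff_eq_0_iff:
  assumes "x \<in> bit_strings n" "y \<in> bit_strings n"
  shows "card {i. i < n \<and> x ! i \<noteq> y ! i} = 0 \<longleftrightarrow> x = y"
  using assms by (auto simp: bit_strings_def list_eq_iff_nth_eq)

text \<open>The only coordinate in which the ends of an edge differ lies either in the tails, the
  heads being equal, or at the head, the tails being equal. Thus the cube consists of two copies of
  the smaller cube and a perfect matching, on which both inductions on the dimension rely.\<close>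

lemma hypercube_edges_Suc:
  "edges (hypercube (Suc n)) =
     (`) (Cons False) ` edges (hypercube n) \<union> (`) (Cons True) ` edges (hypercube n) \<union>
     (\<lambda>x. {False # x, True # x}) ` bit_strings n" (is "?L = ?R")
proof
  show "?L \<subseteq> ?R"
  proof
    fix e assume "e \<in> ?L"
    then obtain x y where e: "e = {x, y}" "x \<in> bit_strings (Suc n)" "y \<in> bit_strings (Suc n)"
      "card {i. i < Suc n \<and> x ! i \<noteq> y ! i} = 1"
      by (auto simp: hypercube_def)
    obtain a x' where x: "x = a # x'" "x' \<in> bit_strings n"
      using e(2) by (cases x) (auto simp: bit_strings_def)
    obtain b y' where y: "y = b # y'" "y' \<in> bit_strings n"
      using e(3) by (cases y) (auto simp: bit_strings_def)
    note xy = x y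
    have d: "(if a = b then 0 else 1) + card {i. i < n \<and> x' ! i \<noteq> y' ! i} = 1"
      using e(4) unfolding xy card_diff_Cons .
    show "e \<in> ?R"
    proof (cases "a = b")
      case True
      with d have "card {i. i < n \<and> x' ! i \<noteq> y' ! i} = 1"
        by simp
      with x(2) y(2) have "{x', y'} \<in> edges (hypercube n)"
        unfolding hypercube_def snd_conv by blast
      then have "Cons a ` {x', y'} \<in> (`) (Cons a) ` edges (hypercube n)"
        by (rule imageI)
      moreover have "e = Cons a ` {x', y'}"
        unfolding e(1) xy True by simp
      ultimately have "e \<in> (`) (Cons a) ` edges (hypercube n)"
        by (simp only:)
      then show ?thesis by (cases a) simp_all
    next
      case False
      with d have "x' = y'"
        using card_diff_eq_0_iff[OF x(2) y(2)] by simp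
      then have "e = {False # x', True # x'}"
        unfolding e(1) xy using False by (cases a) auto
      with x(2) show ?thesis by blast
    qed
  qed
  have "Cons a ` e \<in> ?L" if e: "e \<in> edges (hypercube n)" for a e
  proof -
    obtain x y where xy: "e = {x, y}" "x \<in> bit_strings n" "y \<in> bit_strings n"
      "card {i. i < n \<and> x ! i \<noteq> y ! i} = 1"
      using e by (auto simp: hypercube_def)
    have "card {i. i < Suc n \<and> (a # x) ! i \<noteq> (a # y) ! i} = 1"
      using xy by (simp only: card_diff_Cons) simp
    moreover have "Cons a ` e = {a # x, a # y}" "a # x \<in> bit_strings (Suc n)"
      "a # y \<in> bit_strings (Suc n)"
      using xy by (auto simp: bit_strings_def)
    ultimately show ?thesis
      unfolding hypercube_def snd_conv by blast
  qed
  moreover have "{False # x, True # x} \<in> ?L" if "x \<in> bit_strings n" for x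
  proof -
    have "card {i. i < Suc n \<and> (False # x) ! i \<noteq> (True # x) ! i} = 1"
      by (simp only: card_diff_Cons) simp
    moreover have "False # x \<in> bit_strings (Suc n)" "True # x \<in> bit_strings (Suc n)"
      using that by (auto simp: bit_strings_def)
    ultimately show ?thesis
      unfolding hypercube_def snd_conv by blast
  qed
  ultimately show "?R \<subseteq> ?L" by blast
qed

lemma card_hypercube_edges: "2 * card (edges (hypercube n)) = n * 2 ^ n"
proof (induction n)
  case (Suc n)
  let ?E = "edges (hypercube n)"
  let ?A = "(`) (Cons False) ` ?E" and ?B = "(`) (Cons True) ` ?E"
  let ?C = "(\<lambda>x. {False # x, True # x}) ` bit_strings n"
  have inj: "inj_on ((`) (Cons a)) ?E" for a :: bool
    by (intro inj_onI) (simp add: inj_image_eq_iff)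
  have "inj_on (\<lambda>x. {False # x, True # x}) (bit_strings n)"
    by (auto intro!: inj_onI simp: doubleton_eq_iff)
  then have "card ?A = card ?E" "card ?B = card ?E" "card ?C = 2 ^ n"
    by (simp_all add: inj card_image card_bit_strings)
  moreover have "card (?A \<union> ?B \<union> ?C) = card ?A + card ?B + card ?C"
  proof -
    \<comment> \<open>Strings in the two copies have different heads, so only the empty set could be
      an edge of both.\<close>
    have "?A \<inter> ?B = {}"
      by (auto dest!: hypercube_edge_nonempty)
    moreover have "(?A \<union> ?B) \<inter> ?C = {}"
      by auto
    ultimately show ?thesis
      by (simp add: card_Un_disjoint finite_hypercube_edges finite_bit_strings)
  qed
  ultimately have "card (edges (hypercube (Suc n))) = 2 * card ?E + 2 ^ n"
    by (simp add: hypercube_edges_Suc)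
  with Suc.IH show ?case by simp
qed (simp add: hypercube_edges_0)

text \<open>Splitting \<open>S\<close> by the first bit, the induction hypothesis bounds the edges
  inside each half, the matching adds at most the size of the smaller half, and
  \<open>xlogx_add_ge\<close> absorbs this term. Subcubes attain equality.\<close>

lemma hypercube_edge_isoperimetry:
  assumes "S \<subseteq> bit_strings n"
  shows "2 * real (card {e \<in> edges (hypercube n). e \<subseteq> S}) \<le> real (card S) * log 2 (real (card S))"
  using assms
proof (induction n arbitrary: S)
  case 0
  then have "card S \<le> 1"
    using card_mono[OF finite_bit_strings 0] by (simp add: card_bit_strings)
  \<comment> \<open>In both cases the right-hand side is 0; for the empty set the factor 0 makes the
    value of \<open>log 2 0\<close> irrelevant.\<close>
  then have "card S = 0 \<or> card S = 1" by linarith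
  then show ?case by (auto simp: hypercube_edges_0)
next
  case (Suc n)
  let ?E = "edges (hypercube n)"
  define T where "T a = {x. a # x \<in> S}" for a
  have T: "T a \<subseteq> bit_strings n" for a
    using Suc.prems by (auto simp: T_def bit_strings_def)
  have fT: "finite (T a)" for a
    using T finite_bit_strings by (rule finite_subset)
  have "S = Cons False ` T False \<union> Cons True ` T True"
  proof (intro equalityI subsetI)
    fix x assume x: "x \<in> S"
    then obtain a y where "x = a # y"
      using Suc.prems by (auto simp: bit_strings_def length_Suc_conv)
    with x show "x \<in> Cons False ` T False \<union> Cons True ` T True"
      by (cases a) (auto simp: T_def)
  qed (auto simp: T_def)
  moreover have "card (Cons False ` T False \<union> Cons True ` T True) = card (T False) + card (T True)"
    using fT by (subst card_Un_disjoint) (auto simp: card_image)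
  ultimately have cS: "card S = card (T False) + card (T True)"
    by simp
  define F where "F a = {e \<in> ?E. e \<subseteq> T a}" for a
  have fF: "finite (F a)" for a
    by (simp add: F_def finite_hypercube_edges)
  have "{e \<in> edges (hypercube (Suc n)). e \<subseteq> S} \<subseteq>
      (`) (Cons False) ` F False \<union> (`) (Cons True) ` F True \<union>
      (\<lambda>x. {False # x, True # x}) ` (T False \<inter> T True)" (is "_ \<subseteq> ?A \<union> ?B \<union> ?C")
  proof
    fix e assume e: "e \<in> {e \<in> edges (hypercube (Suc n)). e \<subseteq> S}"
    then consider a e' where "e = Cons a ` e'" "e' \<in> ?E"
      | x where "e = {False # x, True # x}" "x \<in> bit_strings n"
      unfolding hypercube_edges_Suc by blast
    then show "e \<in> ?A \<union> ?B \<union> ?C"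
    proof cases
      case (1 a e')
      with e have "e' \<in> F a" by (auto simp: F_def T_def)
      with 1 show ?thesis by (cases a) auto
    next
      case 2
      with e show ?thesis by (auto simp: T_def)
    qed
  qed
  then have "card {e \<in> edges (hypercube (Suc n)). e \<subseteq> S} \<le> card (?A \<union> ?B \<union> ?C)"
    using fF fT by (intro card_mono) auto
  also have "\<dots> \<le> card ?A + card ?B + card ?C"
    by (meson card_Un_le add_le_mono1 le_trans)
  also have "\<dots> \<le> card (F False) + card (F True) + card (T False \<inter> T True)"
    using fF fT by (intro add_mono card_image_le) auto
  \<comment> \<open>A matching edge inside \<open>S\<close> is determined by a tail that occurs in
    both halves.\<close>
  also have "card (T False \<inter> T True) \<le> min (card (T False)) (card (T True))"
    using fT by (simp add: card_mono)
  finally have "real (card {e \<in> edges (hypercube (Suc n)). e \<subseteq> S}) \<le>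
      real (card (F False)) + real (card (F True)) + min (real (card (T False))) (real (card (T True)))"
    by linarith
  moreover have "2 * real (card (F a)) \<le> real (card (T a)) * log 2 (real (card (T a)))" for a
    using Suc.IH[OF T[of a]] by (simp add: F_def)
  note this[of False] this[of True]
  moreover have "a * log 2 a + b * log 2 b + 2 * min a b \<le> (a + b) * log 2 (a + b)"
    if "a \<ge> 0" "b \<ge> 0" for a b :: real
    using xlogx_add_ge[of a b] xlogx_add_ge[of b a] that
    by (cases "a \<le> b") (simp_all add: min_def add.commute)
  from this[of "real (card (T False))" "real (card (T True))"]
  have "real (card (T False)) * log 2 (real (card (T False)))
      + real (card (T True)) * log 2 (real (card (T True)))
      + 2 * min (real (card (T False))) (real (card (T True)))
      \<le> real (card S) * log 2 (real (card S))"
    by (simp add: cS)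
  ultimately show ?case by linarith
qed

section \<open>Averaging over the color groups\<close>

lemma edge_2_coloring_sum_card_verts_le:
  assumes "edge_2_coloring G c" "finite (verts G)" "finite (edges G)"
    and sub: "\<And>e. e \<in> edges G \<Longrightarrow> e \<subseteq> verts G"
  shows "(\<Sum>a\<in>c ` edges G. card (\<Union>(color_group G c a))) \<le> 2 * card (verts G)"
proof -
  have "(\<Sum>a\<in>c ` edges G. card (\<Union>(color_group G c a))) =
      (\<Sum>a\<in>c ` edges G. \<Sum>v\<in>verts G. if v \<in> \<Union>(color_group G c a) then 1 else 0)"
  proof (rule sum.cong)
    fix a
    have "verts G \<inter> {v. v \<in> \<Union>(color_group G c a)} = \<Union>(color_group G c a)"
      using sub by (auto simp: color_group_def)
    then show "card (\<Union>(color_group G c a)) =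
        (\<Sum>v\<in>verts G. if v \<in> \<Union>(color_group G c a) then 1 else 0)"
      using assms(2) by (simp add: sum.If_cases)
  qed simp
  \<comment> \<open>Double counting of the pairs of a color and a vertex it touches: after the swap,
    the inner sum is the number of colors at \<open>v\<close>.\<close>
  also have "\<dots> = (\<Sum>v\<in>verts G. \<Sum>a\<in>c ` edges G. if v \<in> \<Union>(color_group G c a) then 1 else 0)"
    by (rule sum.swap)
  also have "\<dots> \<le> (\<Sum>v\<in>verts G. 2)"
  proof (rule sum_mono)
    fix v assume v: "v \<in> verts G"
    have "c ` edges G \<inter> {a. v \<in> \<Union>(color_group G c a)} = c ` {e \<in> edges G. v \<in> e}"
      by (auto simp: color_group_def intro: rev_image_eqI)
    then show "(\<Sum>a\<in>c ` edges G. if v \<in> \<Union>(color_group G c a) then 1 else 0) \<le> (2::nat)"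
      using assms(1,3) v by (simp add: sum.If_cases edge_2_coloring_def)
  qed
  finally show ?thesis by simp
qed

lemma sum_card_color_groups:
  assumes "finite (edges G)"
  shows "(\<Sum>a\<in>c ` edges G. card (color_group G c a)) = card (edges G)"
  using sum.image_gen[OF assms, of "\<lambda>_. 1 :: nat" c] by (simp add: color_group_def)

lemma hypercube_color_group_ge:
  assumes n: "n \<ge> 1" and c: "edge_2_coloring (hypercube n) c"
  shows "\<exists>a. real (card (color_group (hypercube n) c a)) \<ge> 1 / 2 * real n * 2 powr (real n / 2 - 1)"
proof -
  let ?G = "hypercube n"
  let ?C = "c ` edges ?G"
  let ?E = "\<lambda>a. color_group ?G c a"
  have V: "verts ?G = bit_strings n" by (simp add: hypercube_def)
  \<comment> \<open>Here \<open>n \<ge> 1\<close> enters: some color is used, as the strict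
    comparison of sums below requires.\<close>
  have "card (edges ?G) > 0"
    using card_hypercube_edges[of n] n by (intro Nat.gr0I) auto
  then have C: "?C \<noteq> {}" "finite ?C"
    by (auto simp: finite_hypercube_edges)
  have "(\<Sum>a\<in>?C. card (\<Union>(?E a))) \<le> 2 * 2 ^ n"
    using edge_2_coloring_sum_card_verts_le[OF c]
    by (simp add: V finite_bit_strings finite_hypercube_edges hypercube_edge_subset card_bit_strings)
  then have "n * (\<Sum>a\<in>?C. card (\<Union>(?E a))) \<le> n * (2 * 2 ^ n)"
    by (rule mult_le_mono2)
  \<comment> \<open>The 4 is the product of the two colors allowed per vertex and the two ends of
    each edge.\<close>
  also have "\<dots> = 4 * (\<Sum>a\<in>?C. card (?E a))"
    using card_hypercube_edges[of n] by (simp add: sum_card_color_groups finite_hypercube_edges)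
  finally have "(\<Sum>a\<in>?C. n * card (\<Union>(?E a))) \<le> (\<Sum>a\<in>?C. 4 * card (?E a))"
    by (simp add: sum_distrib_left)
  \<comment> \<open>If \<open>n * card (\<Union>(?E a))\<close> exceeded
    \<open>4 * card (?E a)\<close> for every used color, summation would contradict the previous
    inequality.\<close>
  then obtain a where a: "a \<in> ?C" "n * card (\<Union>(?E a)) \<le> 4 * card (?E a)"
    using sum_strict_mono[OF C(2,1), of "\<lambda>a. 4 * card (?E a)" "\<lambda>a. n * card (\<Union>(?E a))"]
    by (meson not_le)
  define m where "m = real (card (\<Union>(?E a)))"
  have sub: "\<Union>(?E a) \<subseteq> bit_strings n"
    using hypercube_edge_subset by (auto simp: color_group_def)
  obtain e where e: "e \<in> ?E a" using a by (auto simp: color_group_def)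
  then have "\<Union>(?E a) \<noteq> {}"
    using hypercube_edge_nonempty[of e n] by (auto simp: color_group_def)
  then have m: "m > 0"
    unfolding m_def using finite_subset[OF sub finite_bit_strings]
    by (metis card_gt_0_iff of_nat_0_less_iff)
  have dense: "real n * m \<le> 4 * real (card (?E a))"
    using a(2) unfolding m_def by (metis of_nat_le_iff of_nat_mult of_nat_numeral)
  \<comment> \<open>The group is contained in the edge set spanned by its own vertices, to which the
    isoperimetric bound applies.\<close>
  have "card (?E a) \<le> card {e \<in> edges ?G. e \<subseteq> \<Union>(?E a)}"
    by (intro card_mono) (auto simp: finite_hypercube_edges color_group_def)
  then have "2 * real (card (?E a)) \<le> m * log 2 m"
    using hypercube_edge_isoperimetry[OF sub] unfolding m_def by linarith
  \<comment> \<open>Both bounds meet in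
    \<open>n * m \<le> 4 * card (?E a) \<le> 2 * m * log 2 m\<close>; cancelling
    \<open>m > 0\<close> leaves a lower bound on \<open>m\<close> alone.\<close>
  with dense have "m * real n \<le> m * (2 * log 2 m)"
    by (simp add: mult.commute)
  then have "real n / 2 \<le> log 2 m"
    using m by simp
  then have "2 powr (real n / 2) \<le> m"
    using m by (subst (asm) le_log_iff) auto
  then have "real n * 2 powr (real n / 2) \<le> real n * m"
    by (intro mult_left_mono) auto
  \<comment> \<open>The claimed bound is \<open>n / 4 * 2 powr (n / 2)\<close>.\<close>
  with dense have "1 / 2 * real n * 2 powr (real n / 2 - 1) \<le> real (card (?E a))"
    by (simp add: powr_diff)
  then show ?thesis by blast
qed

section \<open>From color groups to \<open>OPT\<close>\<close>

lemma card_color_group_le_largest: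
  assumes "finite (edges G)"
  shows "card (color_group G c a) \<le> largest_group_size G c"
proof -
  \<comment> \<open>The color type may be infinite, but all group sizes are at most
    \<open>card (edges G)\<close>, so \<open>Max\<close> is taken over a finite set.\<close>
  have "range (\<lambda>k. card (color_group G c k)) \<subseteq> {..card (edges G)}"
    using assms by (auto simp: color_group_def intro: card_mono)
  then have "finite (range (\<lambda>k. card (color_group G c k)))"
    by (rule finite_subset) simp
  then show ?thesis
    unfolding largest_group_size_def by (intro Max_ge) auto
qed

text \<open>A constant coloring shows that the set under \<open>LEAST\<close> is nonempty, so the
  minimum is the value of some coloring.\<close>

lemma OPT_attained:
  obtains c :: "'a set \<Rightarrow> nat" where "edge_2_coloring G c" "OPT G = largest_group_size G c"
proof -
  have "card ((\<lambda>_. 0 :: nat) ` A) \<le> 2" for A :: "'a set set"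
    by (simp add: image_constant_conv)
  then have "edge_2_coloring G (\<lambda>_. 0 :: nat)"
    by (simp add: edge_2_coloring_def)
  then have "\<exists>m. \<exists>c :: 'a set \<Rightarrow> nat. edge_2_coloring G c \<and> m = largest_group_size G c"
    by blast
  from LeastI_ex[OF this] show ?thesis
    using that unfolding OPT_def by blast
qed

theorem theorem6:
  fixes n :: nat and k :: real
  assumes "n \<ge> 1" and "k = 2 powr (real n / 2)"
  shows "(\<forall>c :: bool list set \<Rightarrow> 'c. edge_2_coloring (hypercube n) c \<longrightarrow>
            (\<exists>a. real (card (color_group (hypercube n) c a))
                   \<ge> 1 / 2 * real n * 2 powr (real n / 2 - 1))) \<and>
         real (OPT (hypercube n)) \<ge> 1 / 2 * real n * 2 powr (1 / 2 * real n - 1) \<and>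
         1 / 2 * real n * 2 powr (1 / 2 * real n - 1) = 1 / 2 * k * log 2 k"
proof (intro conjI allI impI)
  fix c :: "bool list set \<Rightarrow> 'c"
  assume "edge_2_coloring (hypercube n) c"
  then show "\<exists>a. real (card (color_group (hypercube n) c a)) \<ge> 1 / 2 * real n * 2 powr (real n / 2 - 1)"
    by (rule hypercube_color_group_ge[OF assms(1)])
next
  obtain c :: "bool list set \<Rightarrow> nat"
    where c: "edge_2_coloring (hypercube n) c" "OPT (hypercube n) = largest_group_size (hypercube n) c"
    by (rule OPT_attained)
  obtain a where "real (card (color_group (hypercube n) c a)) \<ge> 1 / 2 * real n * 2 powr (real n / 2 - 1)"
    using hypercube_color_group_ge[OF assms(1) c(1)] by blast
  moreover have "card (color_group (hypercube n) c a) \<le> OPT (hypercube n)"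
    unfolding c(2) by (rule card_color_group_le_largest[OF finite_hypercube_edges])
  ultimately show "real (OPT (hypercube n)) \<ge> 1 / 2 * real n * 2 powr (1 / 2 * real n - 1)"
    by simp
next
  \<comment> \<open>Since \<open>log 2 k = n / 2\<close>, both sides equal
    \<open>n / 4 * 2 powr (n / 2)\<close>.\<close>
  show "1 / 2 * real n * 2 powr (1 / 2 * real n - 1) = 1 / 2 * k * log 2 k"
    by (simp add: assms(2) powr_diff)
qed

end
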